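(* There is a first countable, hereditarily normal Hausdorff space $X$ with $|X| = \mathfrak{c}^+$ such that $X$ is $2^\omega$-coverable but $X$ is not $2^\omega$-partitionable.
   Context: $\mathfrak{c} = 2^{\aleph_0}$, $\mathfrak{c}^+$ is its successor cardinal, and $2^\omega$ denotes the Cantor space. A space is hereditarily normal if every subspace of it is normal. A space $X$ is $2^\omega$-partitionable if there is a partition of $X$ (a family of pairwise disjoint subsets with union $X$) each member of which, with the subspace topology, is homeomorphic to $2^\omega$. A space $X$ is $2^\omega$-coverable if there is a family of subsets of $X$ with union $X$, each member of which, with the subspace topology, is homeomorphic to $2^\omega$. *)

theory Defs
  imports "HOL-Analysis.Analysis"
begin

unbundle cardinal_syntax

definition Cantor_space :: "(nat \<Rightarrow> bool) topology"
  where "Cantor_space = product_topology (\<lambda>_. discrete_topology UNIV) UNIV"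

definition Cantor_coverable :: "'a topology \<Rightarrow> bool"
  where "Cantor_coverable X \<longleftrightarrow>
    (\<exists>\<C>. \<Union>\<C> = topspace X \<and>
         (\<forall>C\<in>\<C>. subtopology X C homeomorphic_space Cantor_space))"

(* Members of the partition are automatically nonempty, being homeomorphic to the Cantor space. *)
definition Cantor_partitionable :: "'a topology \<Rightarrow> bool"
  where "Cantor_partitionable X \<longleftrightarrow>
    (\<exists>\<P>. pairwise disjnt \<P> \<and> \<Union>\<P> = topspace X \<and>
         (\<forall>C\<in>\<P>. subtopology X C homeomorphic_space Cantor_space))"

(* cardSuc continuum is a cardinal order on the type (nat => bool) set, so every space with
   that many points has a homeomorphic copy whose points are taken from this type. *)
definition continuum :: "(nat \<Rightarrow> bool) rel"
  where "continuum = ctwo ^c natLeq"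

end

theory Submission
  imports Defs
begin

text \<open>
  Take one clopen Cantor block for each ordinal below the successor of the continuum, and one
  additional point for each ordinal \<open>\<delta>\<close> of cofinality \<open>\<omega>\<close>; a neighbourhood of that point
  contains every point whose index lies strictly between some \<open>\<beta> < \<delta>\<close> and \<open>\<delta>\<close>. A sequence of
  blocks converging to the additional point at \<open>\<delta>\<close> forms, together with it, a Cantor set.

  In a partition, the Cantor set \<open>C\<close> containing the additional point at \<open>\<delta>\<close> must meet a block of
  index below \<open>\<delta>\<close>, since the additional points alone form a scattered set. But a partition has
  at most continuum many members meeting blocks of index at most \<open>\<beta>\<close>, and these contain at most
  continuum many additional points, so the indices of those are bounded. Iterating the bound
  \<open>\<omega>\<close> times gives a \<open>\<delta>\<close> of cofinality \<open>\<omega>\<close> for which \<open>C\<close> cannot meet any earlier block.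
\<close>

section \<open>Invariance under homeomorphism\<close>

lemma homeomorphic_space_first_countable:
  assumes "X homeomorphic_space Y" and X: "first_countable X"
  shows "first_countable Y"
proof -
  obtain f where f: "homeomorphic_map X Y f"
    using assms(1) homeomorphic_space by blast
  show ?thesis
    unfolding first_countable_def
  proof
    fix y assume "y \<in> topspace Y"
    then obtain x where x: "x \<in> topspace X" and y: "y = f x"
      using f homeomorphic_imp_surjective_map by blast
    then obtain \<B> where B: "countable \<B>" "\<And>V. V \<in> \<B> \<Longrightarrow> openin X V"
      and nb: "\<And>U. openin X U \<Longrightarrow> x \<in> U \<Longrightarrow> \<exists>V\<in>\<B>. x \<in> V \<and> V \<subseteq> U"
      using X unfolding first_countable_def by meson
    show "\<exists>\<B>. countable \<B> \<and> (\<forall>V\<in>\<B>. openin Y V) \<and>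
            (\<forall>U. openin Y U \<and> y \<in> U \<longrightarrow> (\<exists>V\<in>\<B>. y \<in> V \<and> V \<subseteq> U))"
    proof (intro exI conjI ballI allI impI)
      show "countable ((`) f ` \<B>)"
        using B by simp
      show "openin Y V" if "V \<in> (`) f ` \<B>" for V
        using that B f homeomorphic_imp_open_map open_map_def by blast
      fix U assume U: "openin Y U \<and> y \<in> U"
      then have "openin X {x \<in> topspace X. f x \<in> U}"
        using f homeomorphic_imp_continuous_map openin_continuous_map_preimage by blast
      then obtain V where "V \<in> \<B>" "x \<in> V" "V \<subseteq> {x \<in> topspace X. f x \<in> U}"
        using nb x y U by blast
      then show "\<exists>V\<in>(`) f ` \<B>. y \<in> V \<and> V \<subseteq> U"
        using y by blast
    qed
  qed
qed

lemma homeomorphic_map_image_subtopology: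
  assumes "homeomorphic_map X Y f" and "C \<subseteq> topspace X"
  shows "subtopology X C homeomorphic_space subtopology Y (f ` C)"
proof -
  have "f ` C \<subseteq> topspace Y"
    using assms homeomorphic_imp_surjective_map by blast
  then have "f ` (topspace X \<inter> C) = topspace Y \<inter> f ` C"
    using assms by (simp add: inf_absorb2)
  then have "homeomorphic_map (subtopology X C) (subtopology Y (f ` C)) f"
    by (rule homeomorphic_map_subtopologies[OF assms(1)])
  then show ?thesis
    using homeomorphic_space by blast
qed

lemma homeomorphic_space_Cantor_coverable:
  assumes "X homeomorphic_space Y" and "Cantor_coverable X"
  shows "Cantor_coverable Y"
proof -
  obtain f where f: "homeomorphic_map X Y f"
    using assms(1) homeomorphic_space by blast
  obtain \<C> where C: "\<Union>\<C> = topspace X"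
      "\<And>C. C \<in> \<C> \<Longrightarrow> subtopology X C homeomorphic_space Cantor_space"
    using assms(2) unfolding Cantor_coverable_def by blast
  have "\<Union>((`) f ` \<C>) = topspace Y"
    using C(1) homeomorphic_imp_surjective_map[OF f] by (simp flip: image_Union)
  moreover have "subtopology Y (f ` C) homeomorphic_space Cantor_space" if "C \<in> \<C>" for C
  proof -
    have "subtopology X C homeomorphic_space subtopology Y (f ` C)"
      using C(1) that by (intro homeomorphic_map_image_subtopology[OF f]) blast
    then show ?thesis
      using C(2)[OF that] homeomorphic_space_sym homeomorphic_space_trans by metis
  qed
  ultimately show ?thesis
    unfolding Cantor_coverable_def by (intro exI[of _ "(`) f ` \<C>"]) simp
qed

lemma homeomorphic_space_Cantor_partitionable:
  assumes "X homeomorphic_space Y" and "Cantor_partitionable X"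
  shows "Cantor_partitionable Y"
proof -
  obtain f where f: "homeomorphic_map X Y f"
    using assms(1) homeomorphic_space by blast
  obtain \<C> where C: "pairwise disjnt \<C>" "\<Union>\<C> = topspace X"
      "\<And>C. C \<in> \<C> \<Longrightarrow> subtopology X C homeomorphic_space Cantor_space"
    using assms(2) unfolding Cantor_partitionable_def by auto
  have "\<Union>((`) f ` \<C>) = topspace Y"
    using C(2) homeomorphic_imp_surjective_map[OF f] by (simp flip: image_Union)
  moreover have "subtopology Y (f ` C) homeomorphic_space Cantor_space" if "C \<in> \<C>" for C
  proof -
    have "subtopology X C homeomorphic_space subtopology Y (f ` C)"
      using C(2) that by (intro homeomorphic_map_image_subtopology[OF f]) blast
    then show ?thesis
      using C(3)[OF that] homeomorphic_space_sym homeomorphic_space_trans by metis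
  qed
  moreover have "pairwise disjnt ((`) f ` \<C>)"
  proof (clarsimp simp: pairwise_def)
    fix C D assume "C \<in> \<C>" "D \<in> \<C>" "f ` C \<noteq> f ` D"
    then have "disjnt C D" "C \<subseteq> topspace X" "D \<subseteq> topspace X"
      using C(1,2) by (auto simp: pairwise_def)
    then show "disjnt (f ` C) (f ` D)"
      using inj_on_image_Int[OF homeomorphic_imp_injective_map[OF f], of C D]
      by (simp add: disjnt_def)
  qed
  ultimately show ?thesis
    unfolding Cantor_partitionable_def by (intro exI[of _ "(`) f ` \<C>"]) simp
qed

text \<open>Serves to move a space onto a prescribed set of points, possibly of another type. The
  topology on \<open>A\<close> is pulled back along \<open>h\<close>, which makes \<open>h\<close>
  continuous; it is open because every open set of \<open>X\<close> lies in the image of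
  \<open>h\<close>.\<close>

lemma homeomorphic_copy:
  assumes "bij_betw h A (topspace X)"
  obtains Y where "topspace Y = A" "Y homeomorphic_space X"
proof
  let ?Y = "pullback_topology A h X"
  show top: "topspace ?Y = A"
    using assms by (auto simp: topspace_pullback_topology bij_betw_def)
  have "homeomorphic_map ?Y X h"
  proof (rule bijective_open_imp_homeomorphic_map)
    show "continuous_map ?Y X h"
      using continuous_map_pullback[of X X id A h] by simp
    show "open_map ?Y X h"
      unfolding open_map_def openin_pullback_topology
    proof clarify
      fix U assume U: "openin X U"
      then have "U \<subseteq> h ` A"
        using assms openin_subset[OF U] by (simp add: bij_betw_def)
      then have "h ` (h -` U \<inter> A) = U"
        by auto
      then show "openin X (h ` (h -` U \<inter> A))"
        using U by simp
    qed
    show "h ` topspace ?Y = topspace X" "inj_on h (topspace ?Y)"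
      using assms top by (auto simp: bij_betw_def)
  qed
  then show "?Y homeomorphic_space X"
    using homeomorphic_space by blast
qed

section \<open>Spaces with symmetrically interlocking neighbourhoods\<close>

text \<open>The assumption \<open>interlock\<close> is a strong form of monotone normality.\<close>

locale interlocking_base =
  fixes P :: "'p set" and N :: "'p \<Rightarrow> nat \<Rightarrow> 'p set"
  assumes self: "p \<in> P \<Longrightarrow> p \<in> N p n"
    and within: "p \<in> P \<Longrightarrow> N p n \<subseteq> P"
    and antimono: "p \<in> P \<Longrightarrow> m \<le> n \<Longrightarrow> N p n \<subseteq> N p m"
    and nested: "p \<in> P \<Longrightarrow> q \<in> N p n \<Longrightarrow> \<exists>m. N q m \<subseteq> N p n"
    and interlock: "p \<in> P \<Longrightarrow> q \<in> P \<Longrightarrow> N p m \<inter> N q n \<noteq> {} \<Longrightarrow> p \<in> N q n \<or> q \<in> N p m"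
    and separate: "p \<in> P \<Longrightarrow> q \<in> P \<Longrightarrow> p \<noteq> q \<Longrightarrow> \<exists>n. q \<notin> N p n"
begin

definition space :: "'p topology"
  where "space = topology (\<lambda>U. U \<subseteq> P \<and> (\<forall>p\<in>U. \<exists>n. N p n \<subseteq> U))"

lemma openin_space: "openin space U \<longleftrightarrow> U \<subseteq> P \<and> (\<forall>p\<in>U. \<exists>n. N p n \<subseteq> U)"
proof -
  have "istopology (\<lambda>U. U \<subseteq> P \<and> (\<forall>p\<in>U. \<exists>n. N p n \<subseteq> U))"
    unfolding istopology_def
  proof (intro conjI allI impI)
    fix S T
    assume S: "S \<subseteq> P \<and> (\<forall>p\<in>S. \<exists>n. N p n \<subseteq> S)" and T: "T \<subseteq> P \<and> (\<forall>p\<in>T. \<exists>n. N p n \<subseteq> T)"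
    show "S \<inter> T \<subseteq> P"
      using S by blast
    show "\<forall>p\<in>S \<inter> T. \<exists>n. N p n \<subseteq> S \<inter> T"
    proof
      fix p assume p: "p \<in> S \<inter> T"
      then obtain m n where "N p m \<subseteq> S" "N p n \<subseteq> T"
        using S T by blast
      moreover have "N p (max m n) \<subseteq> N p m" "N p (max m n) \<subseteq> N p n"
        using p S antimono[of p m "max m n"] antimono[of p n "max m n"] by auto
      ultimately show "\<exists>n. N p n \<subseteq> S \<inter> T"
        by blast
    qed
  next
    fix \<K> assume *: "\<forall>K\<in>\<K>. K \<subseteq> P \<and> (\<forall>p\<in>K. \<exists>n. N p n \<subseteq> K)"
    then show "\<Union>\<K> \<subseteq> P"
      by blast
    show "\<forall>p\<in>\<Union>\<K>. \<exists>n. N p n \<subseteq> \<Union>\<K>"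
      using * by (meson Union_iff Union_upper subset_trans)
  qed
  then show ?thesis
    by (simp add: space_def)
qed

lemma topspace_space [simp]: "topspace space = P"
proof (rule subset_antisym)
  show "topspace space \<subseteq> P"
    using openin_topspace openin_space by blast
  have "\<exists>n. N p n \<subseteq> P" if "p \<in> P" for p
    using within[OF that] by blast
  then show "P \<subseteq> topspace space"
    by (intro openin_subset) (simp add: openin_space)
qed

lemma openin_N: "p \<in> P \<Longrightarrow> openin space (N p n)"
  by (simp add: openin_space within nested)

lemma first_countable_space: "first_countable space"
  unfolding first_countable_def
proof
  fix p assume "p \<in> topspace space"
  then show "\<exists>\<B>. countable \<B> \<and> (\<forall>V\<in>\<B>. openin space V) \<and>
          (\<forall>U. openin space U \<and> p \<in> U \<longrightarrow> (\<exists>V\<in>\<B>. p \<in> V \<and> V \<subseteq> U))"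
    by (intro exI[of _ "range (N p)"]) (auto simp: openin_N self, meson openin_space)
qed

text \<open>\<open>separate\<close> gives each of the two points a basic neighbourhood that misses
  the other point. By \<open>interlock\<close>, two such neighbourhoods cannot meet.\<close>

lemma Hausdorff_space: "Hausdorff_space space"
  unfolding Hausdorff_space_def
proof (intro allI impI, elim conjE)
  fix p q assume pq: "p \<in> topspace space" "q \<in> topspace space" "p \<noteq> q"
  then obtain m n where "q \<notin> N p m" "p \<notin> N q n"
    using separate by (metis topspace_space)
  then have "disjnt (N p m) (N q n)"
    using interlock[of p q m n] pq by (auto simp: disjnt_def)
  then show "\<exists>U V. openin space U \<and> openin space V \<and> p \<in> U \<and> q \<in> V \<and> disjnt U V"
    using pq openin_N self by (metis topspace_space)
qed

text \<open>Hereditary normality amounts to separating any two separated sets by disjoint open sets.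
  Each point of \<open>S\<close> gets a basic neighbourhood missing \<open>T\<close>, and vice
  versa; by \<open>interlock\<close> no neighbourhood of the first kind meets one of the second, so
  the two unions are disjoint.\<close>

lemma hereditarily_normal_space: "hereditarily normal_space space"
  unfolding hereditarily_normal_separation
proof (intro allI impI)
  fix S T assume "separatedin space S T"
  then have sub: "S \<subseteq> P" "T \<subseteq> P"
    and S: "S \<inter> space closure_of T = {}" and T: "T \<inter> space closure_of S = {}"
    by (auto simp: separatedin_def)
  have avoid: "\<exists>n. N p n \<inter> B = {}" if "p \<in> P" "p \<notin> space closure_of B" for p B
  proof -
    from that obtain U where U: "p \<in> U" "openin space U" "U \<inter> B = {}"
      by (auto simp: in_closure_of)
    then obtain n where "N p n \<subseteq> U"
      by (auto simp: openin_space)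
    with U show ?thesis by blast
  qed
  have "\<forall>p\<in>S. \<exists>n. N p n \<inter> T = {}" "\<forall>q\<in>T. \<exists>n. N q n \<inter> S = {}"
    using avoid sub S T by blast+
  then obtain f g where f: "\<And>p. p \<in> S \<Longrightarrow> N p (f p) \<inter> T = {}"
    and g: "\<And>q. q \<in> T \<Longrightarrow> N q (g q) \<inter> S = {}"
    by metis
  show "\<exists>U V. openin space U \<and> openin space V \<and> S \<subseteq> U \<and> T \<subseteq> V \<and> disjnt U V"
  proof (intro exI conjI)
    show "openin space (\<Union>p\<in>S. N p (f p))" "openin space (\<Union>q\<in>T. N q (g q))"
      using openin_N sub by blast+
    show "S \<subseteq> (\<Union>p\<in>S. N p (f p))" "T \<subseteq> (\<Union>q\<in>T. N q (g q))"
      using self sub by blast+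
    have "N p (f p) \<inter> N q (g q) = {}" if "p \<in> S" "q \<in> T" for p q
      using interlock[of p q "f p" "g q"] f[of p] g[of q] that sub by blast
    then show "disjnt (\<Union>p\<in>S. N p (f p)) (\<Union>q\<in>T. N q (g q))"
      by (fastforce simp: disjnt_def)
  qed
qed

end

section \<open>The Cantor space\<close>

definition cylinder :: "(nat \<Rightarrow> bool) \<Rightarrow> nat \<Rightarrow> (nat \<Rightarrow> bool) set"
  where "cylinder y n = {z. \<forall>i<n. z i = y i}"

lemma topspace_Cantor_space [simp]: "topspace Cantor_space = UNIV"
  by (simp add: Cantor_space_def)

text \<open>A basic open set of the product restricts only finitely many coordinates, all below some
  \<open>n\<close>, so it contains the cylinder of length \<open>n\<close> around each of its
  points. Conversely, a cylinder is a product of singletons below \<open>n\<close> and full factors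
  from there on.\<close>

lemma openin_Cantor_space: "openin Cantor_space U \<longleftrightarrow> (\<forall>y\<in>U. \<exists>n. cylinder y n \<subseteq> U)"
proof (intro iffI ballI)
  fix y assume U: "openin Cantor_space U" "y \<in> U"
  obtain V where "finite {i \<in> UNIV. V i \<noteq> topspace (discrete_topology (UNIV :: bool set))}"
    "y \<in> Pi\<^sub>E UNIV V" "Pi\<^sub>E UNIV V \<subseteq> U"
    using U[unfolded Cantor_space_def openin_product_topology_alt] by meson
  then have V: "finite {i. V i \<noteq> UNIV}" "\<forall>i. y i \<in> V i" "Pi\<^sub>E UNIV V \<subseteq> U"
    by auto
  then obtain n where n: "{i. V i \<noteq> UNIV} \<subseteq> {..<n}"
    using finite_nat_iff_bounded by blast
  have "cylinder y n \<subseteq> Pi\<^sub>E UNIV V"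
  proof
    fix z assume z: "z \<in> cylinder y n"
    have "z i \<in> V i" for i
    proof (cases "i < n")
      case True
      then show ?thesis using z V(2) by (simp add: cylinder_def)
    next
      case False
      then have "V i = UNIV" using n by auto
      then show ?thesis by simp
    qed
    then show "z \<in> Pi\<^sub>E UNIV V" by (simp add: PiE_UNIV_domain)
  qed
  then show "\<exists>n. cylinder y n \<subseteq> U"
    using V by blast
next
  assume R: "\<forall>y\<in>U. \<exists>n. cylinder y n \<subseteq> U"
  show "openin Cantor_space U"
    unfolding Cantor_space_def openin_product_topology_alt
  proof
    fix y assume "y \<in> U"
    then obtain n where n: "cylinder y n \<subseteq> U"
      using R by blast
    let ?V = "\<lambda>i. if i < n then {y i} else UNIV"
    have "finite {i \<in> UNIV. ?V i \<noteq> UNIV}"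
      by (rule finite_subset[of _ "{..<n}"]) auto
    moreover have "y \<in> Pi\<^sub>E UNIV ?V"
      by (simp add: PiE_UNIV_domain)
    moreover have "z \<in> cylinder y n" if "z \<in> Pi\<^sub>E UNIV ?V" for z
      unfolding cylinder_def
    proof (clarsimp)
      fix i assume "i < n"
      with that show "z i = y i" by (auto simp: PiE_iff dest!: spec[of _ i])
    qed
    ultimately show "\<exists>V. finite {i \<in> UNIV. V i \<noteq> topspace (discrete_topology UNIV)} \<and>
        (\<forall>i\<in>UNIV. openin (discrete_topology UNIV) (V i)) \<and> y \<in> Pi\<^sub>E UNIV V \<and> Pi\<^sub>E UNIV V \<subseteq> U"
      using n by (intro exI[of _ ?V]) auto
  qed
qed

lemma compact_Cantor_space: "compact_space Cantor_space"
  by (simp add: Cantor_space_def compact_space_product_topology compact_space_discrete_topology)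

lemma Cantor_space_no_isolated: "\<not> openin Cantor_space {y}"
proof
  assume "openin Cantor_space {y}"
  then obtain n where n: "cylinder y n \<subseteq> {y}"
    by (auto simp: openin_Cantor_space)
  \<comment> \<open>Flipping the first unrestricted coordinate gives a second point of the
    cylinder.\<close>
  have "y(n := \<not> y n) \<in> cylinder y n"
    by (simp add: cylinder_def)
  with n have "y(n := \<not> y n) = y"
    by blast
  then show False
    by (metis fun_upd_same)
qed

text \<open>A trace consisting of one point would be open in \<open>C\<close>, and the homeomorphism
  would carry it to an isolated point of the Cantor space.\<close>

lemma Cantor_subspace_no_isolated:
  assumes "subtopology X C homeomorphic_space Cantor_space" and "openin X U"
  shows "U \<inter> C \<noteq> {p}"
proof
  assume p: "U \<inter> C = {p}"
  obtain f where f: "homeomorphic_map (subtopology X C) Cantor_space f"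
    using assms homeomorphic_space by blast
  have "openin (subtopology X C) {p}"
    using assms(2) p openin_subtopology by metis
  then have "openin Cantor_space (f ` {p})"
    using f homeomorphic_imp_open_map open_map_def by blast
  then show False
    by (simp add: Cantor_space_no_isolated)
qed

text \<open>A continuous injection of a compact space into a Hausdorff space is an embedding. All
  Cantor sets of the covering are obtained in this way.\<close>

lemma continuous_injective_Cantor_image:
  assumes "continuous_map Cantor_space X f" "inj f" "Hausdorff_space X"
  shows "subtopology X (range f) homeomorphic_space Cantor_space"
proof -
  have "range f \<subseteq> topspace X"
    using assms(1) continuous_map_image_subset_topspace by fastforce
  then have "homeomorphic_map Cantor_space (subtopology X (range f)) f"
    using assms by (intro continuous_imp_homeomorphic_map)
      (auto simp: compact_Cantor_space continuous_map_in_subtopology Hausdorff_space_subtopology)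
  then show ?thesis
    using homeomorphic_space homeomorphic_space_sym by blast
qed

section \<open>The successor of the continuum as a well-ordered type\<close>

text \<open>The cardinal power unfolds to the set of all functions between two full types, so this
  is an equality of relations, usable for rewriting, and not merely an order isomorphism.\<close>

lemma continuum_eq: "continuum = |UNIV :: (nat \<Rightarrow> bool) set|"
  by (simp add: continuum_def cexp_def ctwo_def Field_card_of Field_natLeq Func_def)

lemma infinite_bool_sequences: "infinite (UNIV :: (nat \<Rightarrow> bool) set)"
  by (simp add: finite_UNIV_fun)

lemma Card_order_continuum: "Card_order continuum"
  unfolding continuum_eq by (rule card_of_Card_order)

lemma infinite_Field_continuum: "infinite (Field continuum)"
  by (simp add: continuum_eq Field_card_of infinite_bool_sequences)

text \<open>Turning the field of the cardinal order into a type lets it be an instance of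
  \<open>wellorder\<close>, which provides intervals and \<open>LEAST\<close> for ordinals below the
  successor of the continuum.\<close>

typedef csuc = "Field (cardSuc continuum)"
proof -
  have "infinite (Field (cardSuc continuum))"
    using infinite_Field_continuum by (simp add: cardSuc_finite Card_order_continuum)
  then show ?thesis
    using infinite_imp_nonempty by blast
qed

instantiation csuc :: wellorder
begin

definition "a \<le> b \<longleftrightarrow> (Rep_csuc a, Rep_csuc b) \<in> cardSuc continuum"
definition "(a :: csuc) < b \<longleftrightarrow> a \<le> b \<and> a \<noteq> b"

instance
proof -
  have wo: "Well_order (cardSuc continuum)"
    by (simp add: Card_order_continuum cardSuc_Well_order)
  have R: "refl_on (Field (cardSuc continuum)) (cardSuc continuum)"
     "trans (cardSuc continuum)" "antisym (cardSuc continuum)"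
     "total_on (Field (cardSuc continuum)) (cardSuc continuum)" "wf (cardSuc continuum - Id)"
    using wo by (auto simp: order_on_defs)
  show "OFCLASS(csuc, wellorder_class)"
  proof
    fix a b c :: csuc
    show "a \<le> a"
      using R(1) Rep_csuc by (auto simp: less_eq_csuc_def refl_on_def)
    show "a \<le> b \<Longrightarrow> b \<le> c \<Longrightarrow> a \<le> c"
      using R(2) by (auto simp: less_eq_csuc_def dest: transD)
    show anti: "a \<le> b \<Longrightarrow> b \<le> a \<Longrightarrow> a = b"
      using R(3) by (metis less_eq_csuc_def antisymD Rep_csuc_inject)
    show "a < b \<longleftrightarrow> a \<le> b \<and> \<not> b \<le> a"
      using anti \<open>a \<le> a\<close> by (auto simp: less_csuc_def)
    show "a \<le> b \<or> b \<le> a"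
      using R(4) \<open>a \<le> a\<close> Rep_csuc by (metis less_eq_csuc_def Rep_csuc_inject total_on_def)
  next
    fix Q :: "csuc \<Rightarrow> bool" and a
    assume step: "\<And>x. (\<And>y. y < x \<Longrightarrow> Q y) \<Longrightarrow> Q x"
    have "wf (inv_image (cardSuc continuum - Id) Rep_csuc)"
      using R(5) by (rule wf_inv_image)
    moreover have "inv_image (cardSuc continuum - Id) Rep_csuc = {(x, y). x < y}"
      by (auto simp: inv_image_def less_csuc_def less_eq_csuc_def Rep_csuc_inject)
    ultimately have "wf {(x :: csuc, y). x < y}"
      by simp
    then show "Q a"
      by (induction a rule: wf_induct_rule) (use step in auto)
  qed
qed

end

lemma card_csuc: "|UNIV :: csuc set| =o cardSuc continuum"
proof -
  have "bij_betw Rep_csuc UNIV (Field (cardSuc continuum))"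
    by (metis Rep_csuc_inject type_definition.Rep_range[OF type_definition_csuc] bij_betw_def injI)
  then have "|UNIV :: csuc set| =o |Field (cardSuc continuum)|"
    using card_of_ordIso by blast
  then show ?thesis
    using card_of_Field_ordIso[of "cardSuc continuum"] Card_order_continuum cardSuc_Card_order
      ordIso_transitive by blast
qed

text \<open>A proper initial segment of a cardinal order has smaller cardinality than the whole, and
  smaller than a successor cardinal means at most its predecessor.\<close>

lemma card_lessThan_csuc: "|{..<a :: csuc}| \<le>o continuum"
proof -
  have "Rep_csuc ` {..<a} \<subseteq> underS (cardSuc continuum) (Rep_csuc a)"
    by (auto simp: underS_def less_csuc_def less_eq_csuc_def Rep_csuc_inject)
  then have "|{..<a}| \<le>o |underS (cardSuc continuum) (Rep_csuc a)|"
    using card_of_ordLeq by (metis Rep_csuc_inject injI inj_on_subset subset_UNIV)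
  also have "|underS (cardSuc continuum) (Rep_csuc a)| <o cardSuc continuum"
    by (simp add: Card_order_continuum cardSuc_Card_order card_of_underS Rep_csuc)
  finally show ?thesis
    using Card_order_continuum card_of_Card_order cardSuc_ordLeq_ordLess by blast
qed

lemma card_UN_continuum:
  assumes "|I| \<le>o continuum" "\<And>i. i \<in> I \<Longrightarrow> |A i| \<le>o continuum"
  shows "|\<Union>i\<in>I. A i| \<le>o continuum"
  using assms infinite_bool_sequences unfolding continuum_eq by (intro card_of_UNION_ordLeq_infinite) auto

lemma card_insert_continuum:
  assumes "|A| \<le>o continuum" shows "|insert a A| \<le>o continuum"
  unfolding insert_is_Un[of a A]
proof (rule card_of_Un_ordLeq_infinite_Field)
  show "|{a}| \<le>o continuum"
    unfolding continuum_eq by (simp add: card_of_singl_ordLeq)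
qed (use assms infinite_Field_continuum Card_order_continuum in auto)

text \<open>Regularity of the successor cardinal: if \<open>A\<close> were unbounded, the closed
  initial segments up to its elements would cover the type, a union of at most continuum many sets
  of size at most continuum.\<close>

lemma bounded_csuc:
  assumes "|A :: csuc set| \<le>o continuum"
  shows "\<exists>b. \<forall>a\<in>A. a < b"
proof (rule ccontr)
  assume "\<nexists>b. \<forall>a\<in>A. a < b"
  then have "UNIV = (\<Union>a\<in>A. insert a {..<a})"
    by (auto simp: not_less) (metis le_less)
  then have "|UNIV :: csuc set| \<le>o continuum"
    using card_UN_continuum[OF assms, of "\<lambda>a. insert a {..<a}"]
    by (simp add: card_insert_continuum card_lessThan_csuc)
  then have "cardSuc continuum \<le>o continuum"
    using card_csuc ordIso_ordLeq_trans ordIso_symmetric by blast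
  then show False
    using cardSuc_greater[OF Card_order_continuum] not_ordLess_ordLeq by blast
qed

section \<open>Cantor blocks converging to limit ordinals\<close>

definition ladder :: "csuc \<Rightarrow> (nat \<Rightarrow> csuc) \<Rightarrow> bool"
  where "ladder \<delta> s \<longleftrightarrow> strict_mono s \<and> (\<forall>n. s n < \<delta>) \<and> (\<forall>\<beta><\<delta>. \<exists>n. \<beta> < s n)"

text \<open>These are the ordinals of cofinality \<omega>; limit ordinals of larger cofinality get
  no additional point.\<close>

definition limits :: "csuc set"
  where "limits = {\<delta>. \<exists>s. ladder \<delta> s}"

text \<open>One ladder is fixed for every \<delta> in \<open>limits\<close>, so that the basic
  neighbourhoods of the additional point at \<delta> can be indexed by natural numbers.\<close>

definition lad :: "csuc \<Rightarrow> nat \<Rightarrow> csuc"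
  where "lad \<delta> = (SOME s. ladder \<delta> s)"

lemma ladder_lad: "\<delta> \<in> limits \<Longrightarrow> ladder \<delta> (lad \<delta>)"
  by (simp add: limits_def lad_def someI_ex)

lemma lad_less: "\<delta> \<in> limits \<Longrightarrow> lad \<delta> n < \<delta>"
  using ladder_lad ladder_def by blast

lemma lad_mono: "\<delta> \<in> limits \<Longrightarrow> m \<le> n \<Longrightarrow> lad \<delta> m \<le> lad \<delta> n"
  using ladder_lad ladder_def by (metis strict_mono_less_eq)

lemma lad_cofinal: "\<delta> \<in> limits \<Longrightarrow> \<beta> < \<delta> \<Longrightarrow> \<exists>n. \<beta> < lad \<delta> n"
  using ladder_lad ladder_def by blast

text \<open>A countable set is bounded, and the least strict upper bound of the sequence is the
  required \<delta>.\<close>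

lemma strict_mono_limit:
  assumes "strict_mono (s :: nat \<Rightarrow> csuc)"
  obtains \<delta> where "ladder \<delta> s"
proof -
  have "|range s| \<le>o continuum"
  proof -
    have "|range s| \<le>o |UNIV :: nat set|"
      by (rule card_of_image)
    also have "|UNIV :: nat set| \<le>o continuum"
      using infinite_bool_sequences unfolding continuum_eq by (simp add: infinite_iff_card_of_nat)
    finally show ?thesis .
  qed
  then obtain b where b: "\<forall>n. s n < b"
    using bounded_csuc by blast
  define \<delta> where "\<delta> = (LEAST b. \<forall>n. s n < b)"
  have \<delta>: "\<forall>n. s n < \<delta>"
    unfolding \<delta>_def by (rule LeastI_ex) (use b in blast)
  moreover have "\<exists>n. \<beta> < s n" if "\<beta> < \<delta>" for \<beta>
  proof -
    have "\<not> (\<forall>n. s n < \<beta>)"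
      using that not_less_Least unfolding \<delta>_def by blast
    then obtain n where "\<beta> \<le> s n"
      by (auto simp: not_less)
    \<comment> \<open>Passing to the next term makes the inequality strict.\<close>
    also have "s n < s (Suc n)"
      using assms by (simp add: strict_mono_Suc_iff)
    finally show ?thesis by blast
  qed
  ultimately have "ladder \<delta> s"
    using assms by (simp add: ladder_def)
  then show thesis by (rule that)
qed

text \<open>\<open>Inr (\<alpha>, y)\<close> is the point \<open>y\<close> of the Cantor block at \<open>\<alpha>\<close>, and \<open>Inl \<delta>\<close> the additional
  point at \<open>\<delta>\<close>, which is placed before the block at \<open>\<delta>\<close>.\<close>

type_synonym point = "csuc + csuc \<times> (nat \<Rightarrow> bool)"

definition points :: "point set"
  where "points = Inl ` limits \<union> range Inr"

text \<open>The interval is closed at \<delta> for additional points but open at \<delta> for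
  blocks, because \<open>Inl \<delta>\<close> precedes the block at \<delta>. Neighbourhoods of a
  block point never leave its block.\<close>

fun nbhd :: "point \<Rightarrow> nat \<Rightarrow> point set" where
  "nbhd (Inl \<delta>) n = Inl ` (limits \<inter> {lad \<delta> n<..\<delta>}) \<union> Inr ` ({lad \<delta> n<..<\<delta>} \<times> UNIV)"
| "nbhd (Inr (\<alpha>, y)) n = Inr ` ({\<alpha>} \<times> cylinder y n)"

lemma mem_nbhd_Inl:
  "Inl \<gamma> \<in> nbhd (Inl \<delta>) n \<longleftrightarrow> \<gamma> \<in> limits \<and> lad \<delta> n < \<gamma> \<and> \<gamma> \<le> \<delta>"
  "Inr (\<alpha>, y) \<in> nbhd (Inl \<delta>) n \<longleftrightarrow> lad \<delta> n < \<alpha> \<and> \<alpha> < \<delta>"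
  by auto

lemma mem_nbhd_Inr:
  "Inl \<gamma> \<notin> nbhd (Inr b) n"
  "Inr (\<alpha>, y) \<in> nbhd (Inr (\<beta>, z)) n \<longleftrightarrow> \<alpha> = \<beta> \<and> y \<in> cylinder z n"
  by (cases b) auto

lemmas mem_nbhd = mem_nbhd_Inl mem_nbhd_Inr

lemma cylinder_self [simp]: "y \<in> cylinder y n"
  by (simp add: cylinder_def)

text \<open>Two cylinders that meet are nested, so the centre of the one with the longer prefix lies
  in the other.\<close>

lemma cylinder_interlock:
  assumes "x \<in> cylinder y m" "x \<in> cylinder z n"
  shows "y \<in> cylinder z n \<or> z \<in> cylinder y m"
  using assms by (cases "m \<le> n") (auto simp: cylinder_def)

interpretation X: interlocking_base points nbhd
proof
  fix p q :: point and m n :: nat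
  assume p: "p \<in> points"
  show "p \<in> nbhd p n"
    using p lad_less by (auto simp: points_def)
  show "nbhd p n \<subseteq> points"
    using p by (auto simp: points_def)
  show "nbhd p n \<subseteq> nbhd p m" if "m \<le> n"
    using p that lad_mono[OF _ that] by (fastforce simp: points_def cylinder_def)
  show "\<exists>m. nbhd q m \<subseteq> nbhd p n" if q: "q \<in> nbhd p n"
  proof (cases q)
    case (Inr b)
    \<comment> \<open>The index \<open>n\<close> can be kept: an interval neighbourhood contains the
      whole block of \<open>q\<close>, and a cylinder of length \<open>n\<close> equals the one
      around any of its points.\<close>
    then have "nbhd q n \<subseteq> nbhd p n"
      using p q by (cases b) (auto simp: points_def cylinder_def)
    then show ?thesis ..
  next
    case (Inl \<gamma>)
    then obtain \<delta> where \<delta>: "p = Inl \<delta>" "lad \<delta> n < \<gamma>" "\<gamma> \<le> \<delta>" "\<gamma> \<in> limits"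
      using p q by (auto simp: points_def)
    \<comment> \<open>Since the left end of the interval at \<delta> is below \<gamma>, the ladder
      of \<gamma> eventually passes it.\<close>
    then obtain m where "lad \<delta> n < lad \<gamma> m"
      using lad_cofinal by blast
    then have "nbhd q m \<subseteq> nbhd p n"
      using \<delta> Inl by (auto simp: image_iff)
    then show ?thesis ..
  qed
  assume q: "q \<in> points"
  show "p \<in> nbhd q n \<or> q \<in> nbhd p m" if ne: "nbhd p m \<inter> nbhd q n \<noteq> {}"
  proof -
    obtain x where x: "x \<in> nbhd p m" "x \<in> nbhd q n"
      using ne by blast
    obtain \<xi> where \<xi>: "x = Inl \<xi> \<or> (\<exists>w. x = Inr (\<xi>, w))"
      by (cases x) auto
    show ?thesis
    proof (cases p; cases q)
      fix \<delta> \<gamma> assume pq: "p = Inl \<delta>" "q = Inl \<gamma>"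
      then have "\<delta> \<in> limits" "\<gamma> \<in> limits"
        using p q by (auto simp: points_def)
      moreover have "lad \<delta> m < \<xi>" "\<xi> \<le> \<delta>" "lad \<gamma> n < \<xi>" "\<xi> \<le> \<gamma>"
        using x \<xi> pq by (auto simp: mem_nbhd simp del: nbhd.simps)
      \<comment> \<open>If \<delta> \<le> \<gamma>, the index \<xi> of the common point gives
        \<open>lad \<gamma> n\<close> < \<xi> \<le> \<delta> \<le> \<gamma>, so
        \<open>Inl \<delta>\<close> lies in the neighbourhood of \<open>Inl \<gamma>\<close>; the
        other case is symmetric.\<close>
      ultimately show ?thesis
        using pq by (cases "\<delta> \<le> \<gamma>") (auto simp: mem_nbhd simp del: nbhd.simps)
    next
      fix \<delta> b assume "p = Inl \<delta>" "q = Inr b"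
      then show ?thesis
        using x \<xi> by (cases b) (auto simp: mem_nbhd simp del: nbhd.simps)
    next
      fix \<delta> b assume "p = Inr b" "q = Inl \<delta>"
      then show ?thesis
        using x \<xi> by (cases b) (auto simp: mem_nbhd simp del: nbhd.simps)
    next
      fix b c assume "p = Inr b" "q = Inr c"
      then show ?thesis
        using x \<xi> cylinder_interlock[of _ "snd b" m "snd c" n]
        by (cases b; cases c) (auto simp: mem_nbhd simp del: nbhd.simps)
    qed
  qed
  show "\<exists>n. q \<notin> nbhd p n" if "p \<noteq> q"
  proof (cases p)
    case (Inl \<delta>)
    then have \<delta>: "\<delta> \<in> limits"
      using p by (auto simp: points_def)
    show ?thesis
    proof (cases q)
      case q: (Inl \<gamma>)
      show ?thesis
      \<comment> \<open>An index below \<delta> is eventually passed by the ladder; one above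
        \<delta> lies outside every neighbourhood of \<open>Inl \<delta>\<close>.\<close>
      proof (cases "\<gamma> < \<delta>")
        case True
        then obtain n where "\<gamma> < lad \<delta> n"
          using lad_cofinal \<delta> by blast
        then show ?thesis
          using Inl q by (intro exI[of _ n]) auto
      next
        case False
        then show ?thesis
          using Inl q that by auto
      qed
    next
      case q: (Inr c)
      show ?thesis
      proof (cases "fst c < \<delta>")
        case True
        then obtain n where "fst c < lad \<delta> n"
          using lad_cofinal \<delta> by blast
        then show ?thesis
          using Inl q by (intro exI[of _ n]) auto
      next
        case False
        then show ?thesis
          using Inl q by auto
      qed
    qed
  next
    case (Inr b)
    obtain \<alpha> y where b: "b = (\<alpha>, y)" by fastforce
    show ?thesis
    proof (rule ccontr)
      assume "\<nexists>n. q \<notin> nbhd p n"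
      then have all: "q \<in> Inr ` ({\<alpha>} \<times> cylinder y n)" for n
        using Inr b by auto
      then obtain z where z: "q = Inr (\<alpha>, z)"
        by blast
      then have "z \<in> cylinder y n" for n
        using all[of n] by auto
      then have "z i = y i" for i
        unfolding cylinder_def by blast
      then have "z = y"
        by blast
      then show False
        using that z Inr b by simp
    qed
  qed
qed

section \<open>Cantor sets in the space and coverability\<close>

lemma continuous_map_Cantor_into:
  assumes "range f \<subseteq> points" and "\<And>y n. \<exists>m. f ` cylinder y m \<subseteq> nbhd (f y) n"
  shows "continuous_map Cantor_space X.space f"
  unfolding continuous_map_def
proof (intro conjI allI impI)
  show "f \<in> topspace Cantor_space \<rightarrow> topspace X.space"
    using assms(1) by auto
  fix U assume U: "openin X.space U"
  have "\<exists>m. cylinder y m \<subseteq> {x. f x \<in> U}" if y: "f y \<in> U" for y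
  proof -
    obtain n where "nbhd (f y) n \<subseteq> U"
      using U y by (auto simp: X.openin_space)
    then show ?thesis
      using assms(2)[of y n] by blast
  qed
  then show "openin Cantor_space {x \<in> topspace Cantor_space. f x \<in> U}"
    by (simp add: openin_Cantor_space)
qed

lemma Cantor_block: "subtopology X.space (range (\<lambda>y. Inr (\<alpha>, y))) homeomorphic_space Cantor_space"
proof (intro continuous_injective_Cantor_image continuous_map_Cantor_into X.Hausdorff_space)
  show "range (\<lambda>y. Inr (\<alpha>, y)) \<subseteq> points"
    by (auto simp: points_def)
  show "\<exists>m. (\<lambda>y. Inr (\<alpha>, y)) ` cylinder y m \<subseteq> nbhd (Inr (\<alpha>, y)) n" for y n
    by (rule exI[of _ n]) auto
qed (auto intro: injI)

text \<open>A Cantor set through \<open>Inl \<delta>\<close>: a sequence consisting of \<open>k\<close> zeros, a one and a tail \<open>y\<close>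
  is sent to the point \<open>y\<close> of the block of the \<open>k\<close>-th ladder element, and the zero sequence to
  \<open>Inl \<delta>\<close>.\<close>

definition fan :: "csuc \<Rightarrow> (nat \<Rightarrow> bool) \<Rightarrow> point"
  where "fan \<delta> z = (if \<forall>i. \<not> z i then Inl \<delta>
     else let k = LEAST i. z i in Inr (lad \<delta> k, \<lambda>i. z (Suc k + i)))"

lemma fan_zero: "(\<And>i. \<not> z i) \<Longrightarrow> fan \<delta> z = Inl \<delta>"
  by (simp add: fan_def)

lemma fan_nonzero:
  assumes "z k" "\<And>i. i < k \<Longrightarrow> \<not> z i"
  shows "fan \<delta> z = Inr (lad \<delta> k, \<lambda>i. z (Suc k + i))"
proof -
  have "(LEAST i. z i) = k"
    using assms by (intro Least_equality) (auto simp: not_less[symmetric])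
  then show ?thesis
    using assms(1) by (auto simp: fan_def Let_def)
qed

lemma first_one_cases:
  obtains (zero) "\<And>i. \<not> z i" | (nonzero) k where "z k" "\<And>i :: nat. i < k \<Longrightarrow> \<not> z i"
  using exists_least_iff[of z] by metis

text \<open>The index of the block determines the position of the first one, since a ladder is
  injective; the point within the block then determines the tail.\<close>

lemma inj_fan:
  assumes "\<delta> \<in> limits"
  shows "inj (fan \<delta>)"
proof
  fix y z assume eq: "fan \<delta> y = fan \<delta> z"
  have inj: "inj (lad \<delta>)"
    using ladder_lad[OF assms] by (simp add: ladder_def strict_mono_imp_inj_on)
  show "y = z"
  proof (cases y rule: first_one_cases)
    case y: zero
    show ?thesis
    proof (cases z rule: first_one_cases)
      case zero
      with y show ?thesis by auto
    next
      case (nonzero l)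
      with y eq show ?thesis by (simp add: fan_zero fan_nonzero)
    qed
  next
    case y: (nonzero k)
    show ?thesis
    proof (cases z rule: first_one_cases)
      case zero
      with y eq show ?thesis by (simp add: fan_zero fan_nonzero)
    next
      case z: (nonzero l)
      have kl: "k = l" and tl: "(\<lambda>i. y (Suc k + i)) = (\<lambda>i. z (Suc l + i))"
        using eq inj fan_nonzero[of y k, OF y] fan_nonzero[of z l, OF z] by (auto dest: injD)
      show ?thesis
      proof
        fix i
        consider "i < k" | "i = k" | j where "i = Suc k + j"
          by (metis add_Suc less_iff_Suc_add linorder_neqE_nat)
        then show "y i = z i"
          using y z kl fun_cong[OF tl] by cases auto
      qed
    qed
  qed
qed

lemma fan_continuous:
  assumes \<delta>: "\<delta> \<in> limits"
  shows "continuous_map Cantor_space X.space (fan \<delta>)"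
proof (rule continuous_map_Cantor_into)
  show "range (fan \<delta>) \<subseteq> points"
    using \<delta> by (auto simp: fan_def points_def Let_def)
  fix y n
  show "\<exists>m. fan \<delta> ` cylinder y m \<subseteq> nbhd (fan \<delta> y) n"
  proof (cases y rule: first_one_cases)
    case zero
    \<comment> \<open>The neighbourhood excludes the block at \<open>lad \<delta> n\<close> itself,
      so the first one of \<open>z\<close> must come after position \<open>n\<close>; hence the
      length \<open>Suc n\<close>.\<close>
    have "fan \<delta> z \<in> nbhd (fan \<delta> y) n" if z: "z \<in> cylinder y (Suc n)" for z
    proof (cases z rule: first_one_cases)
      case z0: zero
      then show ?thesis
        using zero \<delta> lad_less by (simp add: fan_zero)
    next
      case (nonzero k)
      have "z k = y k" if "k < Suc n"
        using z that by (simp add: cylinder_def)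
      then have "n < k"
        using zero nonzero(1) not_less_eq by blast
      then have "lad \<delta> n < lad \<delta> k"
        using ladder_lad[OF \<delta>] by (simp add: ladder_def strict_mono_less)
      then show ?thesis
        using zero nonzero \<delta> lad_less by (simp add: fan_zero fan_nonzero)
    qed
    then show ?thesis by blast
  next
    case (nonzero k)
    \<comment> \<open>The prefix fixes the block through the first \<open>Suc k\<close> entries and
      then \<open>n\<close> entries of the tail.\<close>
    have "fan \<delta> z \<in> nbhd (fan \<delta> y) n" if z: "z \<in> cylinder y (Suc k + n)" for z
    proof -
      have zk: "z k" "\<And>i. i < k \<Longrightarrow> \<not> z i"
        using z nonzero by (auto simp: cylinder_def)
      have "(\<lambda>i. z (Suc k + i)) \<in> cylinder (\<lambda>i. y (Suc k + i)) n"
        using z by (auto simp: cylinder_def)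
      then show ?thesis
        using fan_nonzero[of y k, OF nonzero] fan_nonzero[of z k, OF zk] by simp
    qed
    then show ?thesis by blast
  qed
qed

lemma Cantor_coverable_space: "Cantor_coverable X.space"
  unfolding Cantor_coverable_def
proof (intro exI conjI)
  \<comment> \<open>The blocks cover all block points, and the fan at \<delta> catches the
    additional point at \<delta>. Fans overlap blocks, which a covering allows.\<close>
  let ?C = "range (\<lambda>\<alpha>. range (\<lambda>y. Inr (\<alpha>, y))) \<union> (\<lambda>\<delta>. range (fan \<delta>)) ` limits"
  have "range (fan \<delta>) \<subseteq> points" if "\<delta> \<in> limits" for \<delta>
    using that by (auto simp: fan_def points_def Let_def)
  moreover have "range (\<lambda>y. Inr (\<alpha>, y)) \<subseteq> points" for \<alpha>
    by (auto simp: points_def)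
  moreover have "points \<subseteq> \<Union>?C"
  proof
    fix p assume "p \<in> points"
    then consider \<delta> where "p = Inl \<delta>" "\<delta> \<in> limits" | \<alpha> y where "p = Inr (\<alpha>, y)"
      by (auto simp: points_def)
    then show "p \<in> \<Union>?C"
    proof cases
      case 1
      have "p \<in> range (fan \<delta>)"
        using 1 by (intro range_eqI[of _ _ "\<lambda>_. False"]) (simp add: fan_def)
      with 1 show ?thesis by blast
    next
      case 2
      then show ?thesis by blast
    qed
  qed
  ultimately have "\<Union>?C = points"
    by blast
  then show "\<Union>?C = topspace X.space"
    by simp
  show "\<forall>C\<in>?C. subtopology X.space C homeomorphic_space Cantor_space"
    using Cantor_block
      continuous_injective_Cantor_image[OF fan_continuous inj_fan X.Hausdorff_space]
    by auto
qed

section \<open>Failure of partitionability\<close>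

text \<open>Otherwise the limit point of least index in \<open>C\<close> would be isolated in \<open>C\<close>.\<close>

lemma Cantor_set_meets_earlier_block:
  assumes C: "subtopology X.space C homeomorphic_space Cantor_space" "C \<subseteq> points"
    and \<delta>: "Inl \<delta> \<in> C"
  obtains \<alpha> y where "\<alpha> < \<delta>" "Inr (\<alpha>, y) \<in> C"
proof -
  define \<gamma> where "\<gamma> = (LEAST \<gamma>. Inl \<gamma> \<in> C)"
  have \<gamma>: "Inl \<gamma> \<in> C"
    unfolding \<gamma>_def using \<delta> by (rule LeastI)
  have min: "\<gamma> \<le> \<epsilon>" if "Inl \<epsilon> \<in> C" for \<epsilon>
    unfolding \<gamma>_def using that by (rule Least_le)
  have \<gamma>p: "Inl \<gamma> \<in> points"
    using \<gamma> C by blast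
  have "nbhd (Inl \<gamma>) 0 \<inter> C \<noteq> {Inl \<gamma>}"
    using Cantor_subspace_no_isolated[OF C(1)] X.openin_N[OF \<gamma>p] by blast
  then obtain q where q: "q \<in> nbhd (Inl \<gamma>) 0" "q \<in> C" "q \<noteq> Inl \<gamma>"
    using X.self[OF \<gamma>p] \<gamma> by blast
  show thesis
  proof (cases q)
    case (Inl \<epsilon>)
    then show ?thesis
      using q min[of \<epsilon>] by auto
  next
    case (Inr b)
    then have "fst b < \<gamma>"
      using q by auto
    also have "\<gamma> \<le> \<delta>"
      using min \<delta> .
    finally show ?thesis
      using that[of "fst b" "snd b"] q Inr by simp
  qed
qed

lemma card_homeomorphic_Cantor:
  assumes "subtopology X C homeomorphic_space Cantor_space" "C \<subseteq> topspace X"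
  shows "|C| \<le>o continuum"
proof -
  obtain f where "homeomorphic_map (subtopology X C) Cantor_space f"
    using assms homeomorphic_space by blast
  then have "inj_on f C"
    using assms(2) homeomorphic_imp_injective_map by (fastforce simp: inf_absorb2)
  then show ?thesis
    unfolding continuum_eq using card_of_ordLeq by blast
qed

lemma not_Cantor_partitionable_space: "\<not> Cantor_partitionable X.space"
proof
  assume "Cantor_partitionable X.space"
  then obtain \<P> where disj: "pairwise disjnt \<P>" and cover: "\<Union>\<P> = points"
    and Cantor: "\<And>C. C \<in> \<P> \<Longrightarrow> subtopology X.space C homeomorphic_space Cantor_space"
    unfolding Cantor_partitionable_def by auto
  have small: "|C| \<le>o continuum" if "C \<in> \<P>" for C
    using card_homeomorphic_Cantor[OF Cantor[OF that]] that cover by auto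
  define mates where "mates p = {\<delta>. \<exists>C\<in>\<P>. p \<in> C \<and> Inl \<delta> \<in> C}" for p
  define early where "early \<beta> = (\<Union>p \<in> Inr ` ({..\<beta>} \<times> UNIV). mates p)" for \<beta>
  have mates: "|mates p| \<le>o continuum" if p: "p \<in> points" for p
  proof -
    obtain C where C: "C \<in> \<P>" "p \<in> C"
      using p cover by blast
    \<comment> \<open>By disjointness \<open>C\<close> is the only member containing
      \<open>p\<close>, so all mates of \<open>p\<close> come from this one set.\<close>
    then have "Inl ` mates p \<subseteq> C"
      using disj by (fastforce simp: mates_def pairwise_def disjnt_def)
    then have "|mates p| \<le>o |C|"
      using card_of_ordLeq by (metis inj_Inl)
    then show ?thesis
      using small[OF C(1)] ordLeq_transitive by blast
  qed
  have early: "|early \<beta>| \<le>o continuum" for \<beta>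
    unfolding early_def
  proof (rule card_UN_continuum)
    have "|{..\<beta>}| \<le>o continuum"
      using card_insert_continuum[OF card_lessThan_csuc[of \<beta>], of \<beta>]
      by (simp add: ivl_disj_un_singleton(2)[symmetric])
    then have "|{..\<beta>} \<times> (UNIV :: (nat \<Rightarrow> bool) set)| \<le>o continuum"
      using infinite_Field_continuum Card_order_continuum
      by (intro card_of_Times_ordLeq_infinite_Field) (auto simp: continuum_eq card_of_Card_order ordLeq_refl)
    then show "|Inr ` ({..\<beta>} \<times> (UNIV :: (nat \<Rightarrow> bool) set)) :: point set| \<le>o continuum"
      using card_of_image ordLeq_transitive by blast
  qed (auto simp: points_def intro!: mates)
  \<comment> \<open>Inserting \<beta> forces the bound above \<beta>, so that iterating it gives a
    strictly increasing sequence.\<close>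
  have "\<exists>b. \<forall>\<delta>\<in>insert \<beta> (early \<beta>). \<delta> < b" for \<beta>
    using bounded_csuc[OF card_insert_continuum[OF early]] .
  then obtain g where g: "\<And>\<beta>. \<beta> < g \<beta>" "\<And>\<beta> \<delta>. \<delta> \<in> early \<beta> \<Longrightarrow> \<delta> < g \<beta>"
    by (metis insertI1 insertI2)
  \<comment> \<open>The starting value is arbitrary.\<close>
  define s where "s n = (g ^^ n) undefined" for n
  have s_Suc: "s (Suc n) = g (s n)" for n
    by (simp add: s_def)
  have "strict_mono s"
    by (simp add: strict_mono_Suc_iff s_Suc g)
  then obtain \<delta> where \<delta>: "ladder \<delta> s"
    by (rule strict_mono_limit)
  then have "Inl \<delta> \<in> points"
    by (auto simp: points_def limits_def)
  then obtain C where C: "C \<in> \<P>" "Inl \<delta> \<in> C"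
    using cover by blast
  then obtain \<alpha> y where \<alpha>: "\<alpha> < \<delta>" "Inr (\<alpha>, y) \<in> C"
    using Cantor_set_meets_earlier_block Cantor cover by (metis Union_upper)
  then obtain n where "\<alpha> < s n"
    using \<delta> by (auto simp: ladder_def)
  \<comment> \<open>The member \<open>C\<close> through \<open>Inl \<delta>\<close> meets a block of
    index below \<open>s n\<close>, so \<delta> is already bounded by the next iterate, which itself
    lies below \<delta>.\<close>
  then have "\<delta> \<in> early (s n)"
    using C \<alpha> by (force simp: early_def mates_def)
  then have "\<delta> < s (Suc n)"
    using g by (simp add: s_Suc)
  moreover have "s (Suc n) < \<delta>"
    using \<delta> by (simp add: ladder_def)
  ultimately show False
    by simp
qed

section \<open>Cardinality and transfer to the required type\<close>

text \<open>The points embed into a sum and product of sets of size at most the successor of the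
  continuum, and one point from every block gives the lower bound.\<close>

lemma card_points: "|points| =o cardSuc continuum"
proof -
  let ?c = "cardSuc continuum"
  have co: "Card_order ?c"
    by (simp add: Card_order_continuum cardSuc_Card_order)
  have inf: "infinite (Field ?c)"
    using infinite_Field_continuum by (simp add: cardSuc_finite Card_order_continuum)
  have U: "|UNIV :: csuc set| \<le>o ?c"
    using card_csuc ordIso_iff_ordLeq by blast
  have R: "|UNIV :: (nat \<Rightarrow> bool) set| \<le>o ?c"
    using cardSuc_ordLeq[OF Card_order_continuum] by (simp add: continuum_eq)
  have "|(UNIV :: csuc set) <+> (UNIV :: csuc set) \<times> (UNIV :: (nat \<Rightarrow> bool) set)| \<le>o ?c"
    by (intro card_of_Plus_ordLeq_infinite_Field card_of_Times_ordLeq_infinite_Field inf U R co)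
  moreover have "points \<subseteq> UNIV <+> UNIV \<times> UNIV"
    by (auto simp: points_def)
  ultimately have "|points| \<le>o ?c"
    using card_of_mono1 ordLeq_transitive by blast
  moreover have "|UNIV :: csuc set| \<le>o |points|"
  proof -
    have "inj (\<lambda>\<alpha>. Inr (\<alpha>, undefined) :: point)" "range (\<lambda>\<alpha>. Inr (\<alpha>, undefined)) \<subseteq> points"
      by (auto simp: points_def intro: injI)
    then show ?thesis
      using card_of_ordLeq by blast
  qed
  then have "?c \<le>o |points|"
    using card_csuc ordIso_ordLeq_trans ordIso_symmetric by blast
  ultimately show ?thesis
    by (simp add: ordIso_iff_ordLeq)
qed

theorem theorem2p4:
  shows "\<exists>X :: (nat \<Rightarrow> bool) set topology.
    first_countable X \<and> hereditarily normal_space X \<and> Hausdorff_space X \<and>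
    |topspace X| =o cardSuc continuum \<and>
    Cantor_coverable X \<and> \<not> Cantor_partitionable X"
proof -
  \<comment> \<open>The constructed space lives on the type \<open>point\<close>; a bijection with
    the field of the cardinal gives a homeomorphic copy on sets of Boolean sequences.\<close>
  have "|Field (cardSuc continuum)| =o |points|"
    using card_points card_of_Field_ordIso[OF cardSuc_Card_order[OF Card_order_continuum]]
      ordIso_symmetric ordIso_transitive by blast
  then obtain h where "bij_betw h (Field (cardSuc continuum)) points"
    using card_of_ordIso by blast
  then obtain Y where Y: "topspace Y = Field (cardSuc continuum)" "Y homeomorphic_space X.space"
    using homeomorphic_copy[of h _ X.space] by auto
  then have YX: "X.space homeomorphic_space Y"
    using homeomorphic_space_sym by blast
  show ?thesis
  proof (intro exI conjI)
    show "first_countable Y"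
      using homeomorphic_space_first_countable YX X.first_countable_space .
    show "hereditarily normal_space Y"
      using homeomorphic_hereditarily_normal_space YX X.hereditarily_normal_space by blast
    show "Hausdorff_space Y"
      using homeomorphic_Hausdorff_space YX X.Hausdorff_space by blast
    show "|topspace Y| =o cardSuc continuum"
      by (simp add: Y card_of_Field_ordIso cardSuc_Card_order Card_order_continuum)
    show "Cantor_coverable Y"
      using homeomorphic_space_Cantor_coverable YX Cantor_coverable_space .
    show "\<not> Cantor_partitionable Y"
      using homeomorphic_space_Cantor_partitionable Y(2) not_Cantor_partitionable_space by blast
  qed
qed

end
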